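(* Let $\chi$ be a Dirichlet character of conductor $f\in\mathbb{Z}^+$ and let $n$ be a positive integer. Then $$L_q(1-n,\chi\mid w_1)=-\frac{\beta_{n,\chi}(q\mid w_1)}{n}.$$
   Context: Let $q\in\mathbb{C}$ with $0<|q|<1$, fix a value of $\log q$, and put $q^x=\exp(x\log q)$, $[x]=\frac{1-q^x}{1-q}$. Let $w_1\in\mathbb{C}$ with $w_1\ne0$ and $|q^{w_1}|<1$. A Dirichlet character of conductor $f$ is viewed as a primitive character modulo $f$. The generalized Barnes' type Changhee $q$-Bernoulli numbers attached to $\chi$, $\beta_{n,\chi}(q\mid w_1)$ ($n\ge0$), are defined by $$-w_1t\sum_{m=1}^{\infty}\chi(m)q^{w_1m}e^{[w_1m]t}=\sum_{n=0}^{\infty}\beta_{n,\chi}(q\mid w_1)\frac{t^n}{n!}.$$ The Dirichlet type Changhee $q$-$L$-function is $$L_q(s,\chi\mid w_1)=w_1\sum_{m=1}^{\infty}\frac{\chi(m)q^{w_1m}}{[w_1m]^s},\qquad s\in\mathbb{C}.$$ At $s=1-n$ with $n\ge1$ an integer, $[w_1m]^{-s}$ is the ordinary power $[w_1m]^{n-1}$. *)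

theory Defs
  imports "HOL-Complex_Analysis.Complex_Analysis"
begin

definition dirichlet_character :: "nat \<Rightarrow> (int \<Rightarrow> complex) \<Rightarrow> bool" where
  "dirichlet_character N chi \<longleftrightarrow>
     N > 0 \<and>
     (\<forall>a b. chi (a * b) = chi a * chi b) \<and>
     (\<forall>a. chi (a + int N) = chi a) \<and>
     (\<forall>a. chi a \<noteq> 0 \<longleftrightarrow> coprime a (int N))"

definition induced_modulus :: "nat \<Rightarrow> (int \<Rightarrow> complex) \<Rightarrow> nat \<Rightarrow> bool" where
  "induced_modulus N chi d \<longleftrightarrow>
     d dvd N \<and>
     (\<exists>psi. dirichlet_character d psi \<and> (\<forall>a. coprime a (int N) \<longrightarrow> chi a = psi a))"

definition conductor :: "nat \<Rightarrow> (int \<Rightarrow> complex) \<Rightarrow> nat" where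
  "conductor N chi = (LEAST d. induced_modulus N chi d)"

definition primitive_character :: "nat \<Rightarrow> (int \<Rightarrow> complex) \<Rightarrow> bool" where
  "primitive_character f chi \<longleftrightarrow> dirichlet_character f chi \<and> conductor f chi = f"

(* Throughout, l is the chosen value of log q, i.e. exp l = q. *)

definition q_power :: "complex \<Rightarrow> complex \<Rightarrow> complex" where
  "q_power l x = exp (x * l)"

definition q_number :: "complex \<Rightarrow> complex \<Rightarrow> complex \<Rightarrow> complex" where
  "q_number q l x = (1 - q_power l x) / (1 - q)"

(* The series over m >= 1 are indexed by Suc m with m >= 0. *)

definition changhee_gen_fun ::
    "complex \<Rightarrow> complex \<Rightarrow> complex \<Rightarrow> (int \<Rightarrow> complex) \<Rightarrow> complex \<Rightarrow> complex" where
  "changhee_gen_fun q l w chi t =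
     - w * t * (\<Sum>m. chi (int (Suc m)) * q_power l (w * of_nat (Suc m))
                        * exp (q_number q l (w * of_nat (Suc m)) * t))"

(* The unique coefficient sequence of the exponential power series expansion
   of the generating function around t = 0. *)

definition changhee_bernoulli ::
    "complex \<Rightarrow> complex \<Rightarrow> complex \<Rightarrow> (int \<Rightarrow> complex) \<Rightarrow> nat \<Rightarrow> complex" where
  "changhee_bernoulli q l w chi =
     (THE \<beta>. changhee_gen_fun q l w chi has_fps_expansion Abs_fps (\<lambda>n. \<beta> n / fact n))"

(* The complex power is the principal branch. If cmod (q_power l w) < 1 and q \<noteq> 1, the base
   q_number q l (w * m) is nonzero, so at integers s = 1 - n
   its reciprocal power is the ordinary power with exponent n - 1. *)

definition changhee_L ::
    "complex \<Rightarrow> complex \<Rightarrow> complex \<Rightarrow> (int \<Rightarrow> complex) \<Rightarrow> complex \<Rightarrow> complex" where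
  "changhee_L q l w chi s =
     w * (\<Sum>m. chi (int (Suc m)) * q_power l (w * of_nat (Suc m))
                 / q_number q l (w * of_nat (Suc m)) powr s)"

end

theory Submission
  imports Defs
begin

text \<open>
  The value at \<open>s = 1 - n\<close> is a power moment of a series of exponentials. For coefficients
  \<open>a\<^sub>m\<close> with \<open>\<Sum> |a\<^sub>m| < \<infinity>\<close> and bounded exponents \<open>b\<^sub>m\<close>, expanding each exponential in
  \<open>\<Sum> a\<^sub>m exp (b\<^sub>m t)\<close> gives an absolutely convergent double series, so the sum is entire and
  its coefficient at \<open>t\<^sup>k / k!\<close> is the moment \<open>\<Sum> a\<^sub>m b\<^sub>m\<^sup>k\<close>
  (\<open>exponential_series_has_fps_expansion\<close>).

  This applies to \<open>a\<^sub>m = \<chi>(m) q\<^bsup>w m\<^esup>\<close> and \<open>b\<^sub>m = [w m]\<close>: a Dirichlet character takes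
  finitely many values, while \<open>q\<^bsup>w m\<^esup>\<close> is the \<open>m\<close>-th power of a number of modulus less than
  \<open>1\<close>, so the \<open>a\<^sub>m\<close> decay geometrically and the \<open>b\<^sub>m\<close> stay bounded. The prefactor \<open>- w t\<close>
  of the generating function shifts the coefficients by one place, and the passage from
  \<open>t\<^bsup>n-1\<^esup> / (n-1)!\<close> to \<open>t\<^sup>n / n!\<close> produces the factor \<open>n\<close> in
  \<open>\<beta>\<^sub>n = - n w \<Sum> a\<^sub>m b\<^sub>m\<^bsup>n-1\<^esup>\<close> (\<open>changhee_bernoulli_eq_moment\<close>). The same moment is the
  \<open>L\<close>-series at \<open>1 - n\<close>, because no \<open>[w m]\<close> vanishes and so the principal power with an
  integer exponent is the ordinary one.
\<close>

text \<open>
  Absolute convergence of the double series follows from the product majorant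
  \<open>|a\<^sub>m| (B |t|)\<^sup>k / k!\<close>, in which the bound \<open>B\<close> on the exponents decouples the two indices.
\<close>

lemma exponential_series_has_fps_expansion:
  fixes a b :: "nat \<Rightarrow> complex"
  assumes a: "summable (\<lambda>m. norm (a m))" and b: "\<And>m. norm (b m) \<le> B"
  shows "(\<lambda>t. \<Sum>m. a m * exp (b m * t)) has_fps_expansion
           Abs_fps (\<lambda>k. (\<Sum>m. a m * b m ^ k) / fact k)"
proof (rule has_fps_expansionI, rule always_eventually, rule allI)
  fix t :: complex
  define F where "F = (\<lambda>(m, k). a m * ((b m * t) ^ k /\<^sub>R fact k))"
  define G where "G = (\<lambda>(m, k). norm (a m) * ((B * norm t) ^ k /\<^sub>R fact k))"
  have B: "B \<ge> 0"
    using b[of 0] norm_ge_zero order_trans by blast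
  have moment_summable: "summable (\<lambda>m. norm (a m * b m ^ k))" for k
  proof (rule summable_comparison_test')
    show "summable (\<lambda>m. norm (a m) * B ^ k)"
      using a by (rule summable_mult2)
    show "norm (norm (a m * b m ^ k)) \<le> norm (a m) * B ^ k" for m
      by (auto simp: norm_mult norm_power intro!: mult_left_mono power_mono b)
  qed
  have G_row: "((\<lambda>k. G (m, k)) has_sum norm (a m) * exp (B * norm t)) UNIV" for m
    unfolding G_def prod.case
    by (intro has_sum_cmult_right norm_summable_imp_has_sum exp_converges)
       (use B summable_exp_generic[of "B * norm t"] in simp)
  have G_nonneg: "norm (G p) = G p" for p
    using B by (auto simp: G_def split: prod.splits)
  have "(\<lambda>p. norm (G p)) summable_on UNIV \<times> UNIV"
  proof (subst Infinite_Sum.abs_summable_on_Sigma_iff, unfold G_nonneg, intro conjI ballI)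
    show "(\<lambda>k. G (m, k)) summable_on UNIV" for m
      using G_row by (rule has_sum_imp_summable)
    have "(\<lambda>m. norm (a m) * exp (B * norm t)) summable_on UNIV"
      using a by (intro norm_summable_imp_summable_on) (simp add: norm_mult summable_mult2)
    then show "(\<lambda>m. norm (\<Sum>\<^sub>\<infinity>k. G (m, k))) summable_on UNIV"
      unfolding infsumI[OF G_row] by (simp add: abs_mult)
  qed
  then have "(\<lambda>p. norm (F p)) summable_on UNIV \<times> UNIV"
  proof (rule Infinite_Sum.abs_summable_on_comparison_test)
    fix p :: "nat \<times> nat"
    obtain m k where p: "p = (m, k)" by fastforce
    have "(norm (b m) * norm t) ^ k \<le> (B * norm t) ^ k"
      by (intro power_mono mult_right_mono b) auto
    then show "norm (F p) \<le> norm (G p)"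
      unfolding G_nonneg
      by (auto simp: F_def G_def p norm_mult norm_power intro!: mult_left_mono divide_right_mono)
  qed
  then have "F summable_on UNIV \<times> UNIV"
    by (rule abs_summable_summable)
  then obtain S where S: "(F has_sum S) (UNIV \<times> UNIV)"
    by (auto simp: summable_on_def)
  have F_row: "((\<lambda>k. F (m, k)) has_sum a m * exp (b m * t)) UNIV" for m
    unfolding F_def prod.case
    by (intro has_sum_cmult_right norm_summable_imp_has_sum exp_converges summable_norm_exp)
  have F_col: "((\<lambda>m. F (m, k)) has_sum (\<Sum>m. a m * b m ^ k) / fact k * t ^ k) UNIV" for k
  proof -
    have "((\<lambda>m. a m * b m ^ k) has_sum (\<Sum>m. a m * b m ^ k)) UNIV"
      using moment_summable[of k]
      by (intro norm_summable_imp_has_sum) (simp_all add: summable_sums summable_norm_cancel)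
    from has_sum_cmult_left[OF this, of "t ^ k / fact k"]
    show ?thesis
      by (simp add: F_def power_mult_distrib scaleR_conv_of_real divide_inverse mult_ac)
  qed
  have "(\<lambda>m. a m * exp (b m * t)) sums S"
    using has_sum_SigmaD[OF S F_row] by (rule has_sum_imp_sums)
  moreover have "((\<lambda>(k, m). F (m, k)) has_sum S) (UNIV \<times> UNIV)"
    using S by (subst has_sum_swap) (simp add: case_prod_unfold)
  then have "(\<lambda>k. (\<Sum>m. a m * b m ^ k) / fact k * t ^ k) sums S"
    by (rule has_sum_imp_sums[OF has_sum_SigmaD]) (simp only: prod.case F_col)
  ultimately show "(\<lambda>k. fps_nth (Abs_fps (\<lambda>k. (\<Sum>m. a m * b m ^ k) / fact k)) k * t ^ k)
                     sums (\<Sum>m. a m * exp (b m * t))"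
    by (simp add: sums_iff)
qed

lemma dirichlet_character_bounded:
  assumes "dirichlet_character N chi"
  obtains C where "\<And>k::nat. norm (chi (int k)) \<le> C"
proof -
  have N: "N > 0" and per: "\<And>a. chi (a + int N) = chi a"
    using assms by (auto simp: dirichlet_character_def)
  have shift: "chi (int (r + j * N)) = chi (int r)" for r j
  proof (induction j)
    case (Suc j)
    show ?case
      using per[of "int (r + j * N)"] Suc by (simp add: algebra_simps)
  qed simp
  have "norm (chi (int k)) \<le> Max ((\<lambda>r. norm (chi (int r))) ` {..<N})" for k
  proof -
    have "chi (int k) = chi (int (k mod N))"
      using shift[of "k mod N" "k div N"] by simp
    then show ?thesis
      using N by (auto intro!: Max_ge)
  qed
  then show thesis by (rule that)
qed

lemma q_power_mult_of_nat: "q_power l (w * of_nat m) = q_power l w ^ m"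
  by (simp add: q_power_def exp_of_nat_mult[symmetric] mult_ac)

lemma norm_q_number_mult_of_nat_le:
  assumes "cmod (q_power l w) \<le> 1"
  shows "norm (q_number q l (w * of_nat m)) \<le> 2 / norm (1 - q)"
proof -
  have "norm (1 - q_power l w ^ m) \<le> norm (1 :: complex) + norm (q_power l w) ^ m"
    using norm_triangle_ineq4[of 1 "q_power l w ^ m"] by (simp add: norm_power)
  also have "\<dots> \<le> 2"
    using power_le_one[of "norm (q_power l w)" m] assms by simp
  finally show ?thesis
    by (simp add: q_number_def q_power_mult_of_nat norm_divide divide_right_mono)
qed

lemma q_number_mult_of_nat_nonzero:
  assumes "cmod (q_power l w) < 1" "q \<noteq> 1" "m > 0"
  shows "q_number q l (w * of_nat m) \<noteq> 0"
proof -
  have "norm (q_power l w ^ m) < 1"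
    using assms by (simp add: norm_power power_less_one_iff)
  then have "q_power l w ^ m \<noteq> 1" by auto
  then show ?thesis
    using assms by (simp add: q_number_def q_power_mult_of_nat)
qed

text \<open>
  Power series expansions at \<open>0\<close> are unique, so the definite description in the
  definition of the numbers is resolved by exhibiting any one expansion.
\<close>

lemma changhee_bernoulli_eqI:
  assumes "changhee_gen_fun q l w chi has_fps_expansion F"
  shows "changhee_bernoulli q l w chi n = fact n * fps_nth F n"
proof -
  have "changhee_bernoulli q l w chi = (\<lambda>n. fact n * fps_nth F n)"
    unfolding changhee_bernoulli_def
  proof (rule the_equality)
    show "changhee_gen_fun q l w chi has_fps_expansion Abs_fps (\<lambda>n. fact n * fps_nth F n / fact n)"
      using assms by (simp add: fps_nth_inverse)
  next
    fix \<beta> assume "changhee_gen_fun q l w chi has_fps_expansion Abs_fps (\<lambda>n. \<beta> n / fact n)"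
    then have "F = Abs_fps (\<lambda>n. \<beta> n / fact n)"
      using assms fps_expansion_unique_complex by blast
    then show "\<beta> = (\<lambda>n. fact n * fps_nth F n)"
      by (auto simp: fun_eq_iff)
  qed
  then show ?thesis by simp
qed

lemma changhee_bernoulli_eq_moment:
  assumes chi: "dirichlet_character f chi" and w: "cmod (q_power l w) < 1"
  shows "changhee_bernoulli q l w chi (Suc k) =
           - of_nat (Suc k) * w * (\<Sum>m. chi (int (Suc m)) * q_power l (w * of_nat (Suc m))
                                         * q_number q l (w * of_nat (Suc m)) ^ k)"
proof -
  define a where "a = (\<lambda>m. chi (int (Suc m)) * q_power l (w * of_nat (Suc m)))"
  define b where "b = (\<lambda>m. q_number q l (w * of_nat (Suc m)))"
  obtain C where C: "\<And>k::nat. norm (chi (int k)) \<le> C"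
    using dirichlet_character_bounded[OF chi] by blast
  have "summable (\<lambda>m. norm (a m))"
  proof (rule summable_comparison_test')
    show "summable (\<lambda>m. C * norm (q_power l w) ^ Suc m)"
      using w by (intro summable_mult) (simp add: summable_mult summable_geometric)
    show "norm (norm (a m)) \<le> C * norm (q_power l w) ^ Suc m" for m
      unfolding a_def q_power_mult_of_nat norm_mult norm_power real_norm_def abs_mult
      using C[of "Suc m"] by (simp add: mult_right_mono del: of_nat_Suc)
  qed
  moreover have "norm (b m) \<le> 2 / norm (1 - q)" for m
    unfolding b_def using w by (intro norm_q_number_mult_of_nat_le) simp
  ultimately have "(\<lambda>t. \<Sum>m. a m * exp (b m * t)) has_fps_expansion
                     Abs_fps (\<lambda>k. (\<Sum>m. a m * b m ^ k) / fact k)" (is "_ has_fps_expansion ?S")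
    by (rule exponential_series_has_fps_expansion)
  then have "(\<lambda>t. - w * (t * (\<Sum>m. a m * exp (b m * t)))) has_fps_expansion
               fps_const (- w) * (fps_X * ?S)"
    by (intro fps_expansion_intros)
  also have "(\<lambda>t. - w * (t * (\<Sum>m. a m * exp (b m * t)))) = changhee_gen_fun q l w chi"
    by (simp add: fun_eq_iff changhee_gen_fun_def a_def b_def mult.assoc)
  finally have "changhee_bernoulli q l w chi (Suc k) =
                  fact (Suc k) * fps_nth (fps_const (- w) * (fps_X * ?S)) (Suc k)"
    by (rule changhee_bernoulli_eqI)
  also have "\<dots> = - of_nat (Suc k) * w * (\<Sum>m. a m * b m ^ k)"
    by (simp add: field_simps del: fps_const_neg)
  finally show ?thesis by (simp add: a_def b_def)
qed

theorem theorem9: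
  fixes q l w\<^sub>1 :: complex and chi :: "int \<Rightarrow> complex" and f n :: nat
  assumes "0 < cmod q" and "cmod q < 1"
    and "exp l = q"
    and "w\<^sub>1 \<noteq> 0" and "cmod (q_power l w\<^sub>1) < 1"
    and "f > 0" and "primitive_character f chi"
    and "n > 0"
  shows "changhee_L q l w\<^sub>1 chi (1 - of_nat n) = - changhee_bernoulli q l w\<^sub>1 chi n / of_nat n"
proof -
  obtain k where n: "n = Suc k"
    using \<open>n > 0\<close> gr0_implies_Suc by blast
  have "q \<noteq> 1" using \<open>cmod q < 1\<close> by auto
  then have "q_number q l (w\<^sub>1 * of_nat (Suc m)) \<noteq> 0" for m
    using assms by (intro q_number_mult_of_nat_nonzero) auto
  \<comment> \<open>For \<open>n = 1\<close> the equation would fail at a zero base, because \<open>0 powr 0 = 0\<close>.\<close>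
  then have term_eq: "c / q_number q l (w\<^sub>1 * of_nat (Suc m)) powr (1 - of_nat n)
                        = c * q_number q l (w\<^sub>1 * of_nat (Suc m)) ^ k" for c m
    by (simp add: n powr_minus powr_nat' divide_inverse del: of_nat_Suc)
       (simp add: powr_minus powr_nat')
  have "changhee_L q l w\<^sub>1 chi (1 - of_nat n) =
          w\<^sub>1 * (\<Sum>m. chi (int (Suc m)) * q_power l (w\<^sub>1 * of_nat (Suc m))
                      * q_number q l (w\<^sub>1 * of_nat (Suc m)) ^ k)"
    unfolding changhee_L_def term_eq ..
  also have "\<dots> = - changhee_bernoulli q l w\<^sub>1 chi n / of_nat n"
    using assms
    by (simp add: n changhee_bernoulli_eq_moment[of f] primitive_character_def del: of_nat_Suc)
  finally show ?thesis .
qed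

end
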